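(* Let $T$ be a rooted, countably infinite and locally finite tree, and let $S:\mathcal{L}_0\to\mathcal{L}_0$ be the forward shift. Then, under the isometric identification of the dual $\mathcal{L}_0^*$ with $L^1(T)$ given by $f\mapsto\Phi_f$, the adjoint $S^*:L^1(T)\to L^1(T)$ is given by $S^*=B$, where $B$ is the backward shift restricted to $L^1(T)$. That is, for every $f\in L^1(T)$, $S^*\Phi_f=\Phi_{Bf}$.
   Context: A tree is an undirected graph (no loops or multiple edges) in which any two vertices are joined by exactly one path; $T$ also denotes its vertex set. It is locally finite if every vertex has finite degree. $T$ has a distinguished vertex $o$, the root; $|v|$ is the length (number of edges) of the path from $o$ to $v$. For $v\neq o$, the parent $\mathrm{par}(v)$ is the vertex preceding $v$ on the unique path from $o$ to $v$; $\mathrm{Chi}(v)$, the set of children of $v$, is the set of vertices with parent $v$. For $f:T\to\mathbb{C}$ define $f':T\to\mathbb{C}$ by $f'(o)=f(o)$ and $f'(v)=f(v)-f(\mathrm{par}(v))$ for $v\neq o$. The little Lipschitz space $\mathcal{L}_0$ is the Banach space of all $f:T\to\mathbb{C}$ with $\lim_{|v|\to\infty}f'(v)=0$, with norm $\|f\|=\sup_{v\in T}|f'(v)|$. $L^1(T)$ is the space of $f:T\to\mathbb{C}$ with $\sum_{v\in T}|f(v)|<\infty$, with the usual norm. The forward shift is $(Sf)(o)=0$, $(Sf)(v)=f(\mathrm{par}(v))$ for $v\ne o$; it is bounded on $\mathcal{L}_0$. The backward shift is $(Bf)(v)=\sum_{w\in\mathrm{Chi}(v)}f(w)$ (empty sum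 equal to $0$). For $f\in L^1(T)$, $\Phi_f:\mathcal{L}_0\to\mathbb{C}$ is the functional $\Phi_f(g)=\sum_{v\in T}f(v)g'(v)$. It is known that $f\mapsto\Phi_f$ is an isometric isomorphism of $L^1(T)$ onto the Banach-space dual $\mathcal{L}_0^*$. $S^*$ is the Banach-space adjoint, $(S^*\Phi)(g)=\Phi(Sg)$. *)

theory Defs
  imports "HOL-Analysis.Analysis" "Graph_Theory.Pair_Digraph"
begin

text \<open>
  An undirected graph without loops and multiple edges is a symmetric loop-free digraph whose
  arcs are pairs of vertices. The vertex set may be infinite. A path is an \<open>apath\<close>, i.e. the list
  of the successive arcs of a walk that visits no vertex twice. The predicate \<open>tree\<close> of
  Graph\_Theory is not usable here, because in a symmetric digraph it counts an edge traversed
  back and forth as a cycle.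
\<close>

locale rooted_tree = pair_bidirected_digraph G
  for G :: "'a pair_pre_digraph" +
  fixes root :: 'a
  assumes root_in_verts: "root \<in> pverts G"
    and unique_path: "\<lbrakk>u \<in> pverts G; v \<in> pverts G\<rbrakk> \<Longrightarrow> \<exists>!p. apath u p v"
begin

definition root_path :: "'a \<Rightarrow> ('a \<times> 'a) list" where
  "root_path v = (THE p. apath root p v)"

definition depth :: "'a \<Rightarrow> nat" where
  "depth v = length (root_path v)"

text \<open>For \<open>v \<noteq> root\<close> the last arc of the path is \<open>(par v, v)\<close>. The value at the root is junk.\<close>

definition par :: "'a \<Rightarrow> 'a" where
  "par v = fst (last (root_path v))"

definition Chi :: "'a \<Rightarrow> 'a set" where
  "Chi v = {w \<in> pverts G. w \<noteq> root \<and> par w = v}"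

definition locally_finite :: bool where
  "locally_finite \<longleftrightarrow> (\<forall>v \<in> pverts G. finite {w. (v, w) \<in> parcs G})"

text \<open>
  A function on the vertex set is represented by its extension by zero to the whole type, so that
  equality of representatives is equality on the vertex set, and the vector space operations are
  the pointwise ones.
\<close>

definition vertex_funs :: "('a \<Rightarrow> complex) set" where
  "vertex_funs = {f. \<forall>v. v \<notin> pverts G \<longrightarrow> f v = 0}"

definition vdiff :: "('a \<Rightarrow> complex) \<Rightarrow> 'a \<Rightarrow> complex" where
  "vdiff f v = (if v = root then f root else f v - f (par v))"

definition little_lipschitz :: "('a \<Rightarrow> complex) set" where
  "little_lipschitz =
     {f \<in> vertex_funs. (vdiff f \<longlongrightarrow> 0) (inf (filtercomap depth at_top) (principal (pverts G)))}"

definition lipschitz_norm :: "('a \<Rightarrow> complex) \<Rightarrow> real" where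
  "lipschitz_norm f = (SUP v \<in> pverts G. norm (vdiff f v))"

definition L1 :: "('a \<Rightarrow> complex) set" where
  "L1 = {f \<in> vertex_funs. (\<lambda>v. norm (f v)) summable_on pverts G}"

definition forward_shift :: "('a \<Rightarrow> complex) \<Rightarrow> 'a \<Rightarrow> complex" where
  "forward_shift f v = (if v \<in> pverts G \<and> v \<noteq> root then f (par v) else 0)"

definition backward_shift :: "('a \<Rightarrow> complex) \<Rightarrow> 'a \<Rightarrow> complex" where
  "backward_shift f v = (\<Sum>w \<in> Chi v. f w)"

definition bounded_operator :: "(('a \<Rightarrow> complex) \<Rightarrow> ('a \<Rightarrow> complex)) \<Rightarrow> bool" where
  "bounded_operator A \<longleftrightarrow>
     A \<in> little_lipschitz \<rightarrow> little_lipschitz \<and>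
     (\<forall>g \<in> little_lipschitz. \<forall>h \<in> little_lipschitz. A (\<lambda>v. g v + h v) = (\<lambda>v. A g v + A h v)) \<and>
     (\<forall>c. \<forall>g \<in> little_lipschitz. A (\<lambda>v. c * g v) = (\<lambda>v. c * A g v)) \<and>
     (\<exists>K. \<forall>g \<in> little_lipschitz. lipschitz_norm (A g) \<le> K * lipschitz_norm g)"

text \<open>Functionals are functions on the carrier \<open>little_lipschitz\<close>, hence \<open>extensional\<close>.\<close>

definition dual :: "(('a \<Rightarrow> complex) \<Rightarrow> complex) set" where
  "dual = {\<Psi> \<in> extensional little_lipschitz.
     (\<forall>g \<in> little_lipschitz. \<forall>h \<in> little_lipschitz. \<Psi> (\<lambda>v. g v + h v) = \<Psi> g + \<Psi> h) \<and>
     (\<forall>c. \<forall>g \<in> little_lipschitz. \<Psi> (\<lambda>v. c * g v) = c * \<Psi> g) \<and>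
     (\<exists>K. \<forall>g \<in> little_lipschitz. norm (\<Psi> g) \<le> K * lipschitz_norm g)}"

definition \<Phi> :: "('a \<Rightarrow> complex) \<Rightarrow> ('a \<Rightarrow> complex) \<Rightarrow> complex" where
  "\<Phi> f = (\<lambda>g \<in> little_lipschitz. \<Sum>\<^sub>\<infinity>v \<in> pverts G. f v * vdiff g v)"

definition adjoint ::
    "(('a \<Rightarrow> complex) \<Rightarrow> ('a \<Rightarrow> complex)) \<Rightarrow>
     (('a \<Rightarrow> complex) \<Rightarrow> complex) \<Rightarrow> (('a \<Rightarrow> complex) \<Rightarrow> complex)" where
  "adjoint A \<Psi> = (\<lambda>g \<in> little_lipschitz. \<Psi> (A g))"

text \<open>The adjoint as an operator on \<open>L1\<close>, through the identification \<open>\<Phi>\<close> of \<open>L1\<close> with \<open>dual\<close>.\<close>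

definition L1_adjoint ::
    "(('a \<Rightarrow> complex) \<Rightarrow> ('a \<Rightarrow> complex)) \<Rightarrow> ('a \<Rightarrow> complex) \<Rightarrow> ('a \<Rightarrow> complex)" where
  "L1_adjoint A f = the_inv_into L1 \<Phi> (adjoint A (\<Phi> f))"

end

end

theory Submission
  imports Defs
begin

text \<open>
  Differentiation intertwines the forward shift with composition by \<open>par\<close>: the derivative of \<open>S g\<close>
  vanishes at the root and equals \<open>g' \<circ> par\<close> elsewhere (\<open>vdiff_forward_shift\<close>). Hence
  \<open>\<Phi>\<^sub>f (S g)\<close> is the sum of \<open>f w * g' (par w)\<close> over all \<open>w \<noteq> root\<close>, and collecting the
  terms with the same parent \<open>v\<close> turns it into the sum of \<open>(B f) v * g' v\<close>. The rearrangement is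
  legitimate because \<open>f\<close> is summable and \<open>g'\<close> is bounded; local finiteness enters in the
  boundedness of \<open>g'\<close> (only finitely many vertices lie below any given depth,
  \<open>finite_depth_less\<close>) and in the finiteness of the sums defining \<open>B f\<close>.

  The identity determines the adjoint as an operator on \<open>L1\<close> because \<open>f\<close> can be recovered
  from \<open>\<Phi>\<^sub>f\<close>: every function on the vertices is the derivative of its sums along the paths
  from the root, so there is a \<open>g\<close> whose derivative is the point mass at a given vertex \<open>u\<close>,
  and \<open>\<Phi>\<^sub>f g = f u\<close> (\<open>\<Phi>_evaluation\<close>).
\<close>

context rooted_tree
begin

section \<open>Parents, depth and local finiteness\<close>

lemma apath_root_path: "v \<in> pverts G \<Longrightarrow> apath root (root_path v) v"
  unfolding root_path_def by (rule theI') (rule unique_path[OF root_in_verts])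

lemma root_path_eqI:
  assumes "apath root p v"
  shows "root_path v = p"
proof -
  have "v \<in> pverts G"
    using assms by (auto simp: apath_def dest: awalk_last_in_verts)
  then show ?thesis
    using unique_path[OF root_in_verts] apath_root_path assms by blast
qed

lemma root_path_root [simp]: "root_path root = []"
  by (rule root_path_eqI) (simp add: apath_Nil_iff root_in_verts)

text \<open>
  An initial segment of a path is a path, so by uniqueness the path to \<open>v\<close> without its last arc
  is the path to the tail of that arc, which is the parent.
\<close>

lemma
  assumes "v \<in> pverts G" "v \<noteq> root"
  shows root_path_par: "root_path v = root_path (par v) @ [(par v, v)]"
    and par_arc: "(par v, v) \<in> parcs G"
proof -
  have path: "apath root (root_path v) v"
    by (rule apath_root_path) fact
  then have "root_path v \<noteq> []"
    using assms(2) by (auto simp: apath_Nil_iff)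
  then obtain p a b where p: "root_path v = p @ [(a, b)]"
    by (metis rev_exhaust surj_pair)
  have par: "par v = a"
    by (simp add: par_def p)
  have "apath root p a \<and> b = v \<and> (a, b) \<in> parcs G"
    using path by (auto simp: p apath_append_iff apath_Cons_iff apath_Nil_iff)
  then have "apath root p a" and b: "b = v" and arc: "(a, b) \<in> parcs G"
    by blast+
  then have "root_path a = p"
    by (intro root_path_eqI)
  then show "root_path v = root_path (par v) @ [(par v, v)]" "(par v, v) \<in> parcs G"
    using p par b arc by simp_all
qed

lemma par_in_verts: "\<lbrakk>v \<in> pverts G; v \<noteq> root\<rbrakk> \<Longrightarrow> par v \<in> pverts G"
  using par_arc in_arcsD1 by blast

lemma depth_par: "\<lbrakk>v \<in> pverts G; v \<noteq> root\<rbrakk> \<Longrightarrow> depth v = Suc (depth (par v))"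
  by (simp add: depth_def root_path_par)

lemma Chi_outside_verts: "v \<notin> pverts G \<Longrightarrow> Chi v = {}"
  by (auto simp: Chi_def dest: par_in_verts)

lemma finite_Chi:
  assumes "locally_finite"
  shows "finite (Chi v)"
proof (cases "v \<in> pverts G")
  case True
  have "Chi v \<subseteq> {w. (v, w) \<in> parcs G}"
    by (auto simp: Chi_def dest: par_arc)
  then show ?thesis
    using assms True finite_subset unfolding locally_finite_def by blast
qed (simp add: Chi_outside_verts)

lemma finite_depth_less:
  assumes "locally_finite"
  shows "finite {v \<in> pverts G. depth v < n}"
proof (induction n)
  case (Suc n)
  let ?V = "{v \<in> pverts G. depth v < n}"
  have "v = root \<or> v \<in> \<Union> (Chi ` ?V)" if "v \<in> pverts G" "depth v < Suc n" for v
    using that depth_par[of v] par_in_verts[of v] by (auto simp: Chi_def)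
  then have "{v \<in> pverts G. depth v < Suc n} \<subseteq> insert root (\<Union> (Chi ` ?V))"
    by blast
  moreover have "finite (insert root (\<Union> (Chi ` ?V)))"
    using Suc finite_Chi[OF assms] by blast
  ultimately show ?case
    by (rule finite_subset)
qed simp

section \<open>The little Lipschitz space and the forward shift\<close>

lemma little_lipschitz_iff:
  "g \<in> little_lipschitz \<longleftrightarrow> g \<in> vertex_funs \<and>
     (\<forall>e>0. \<exists>N. \<forall>v \<in> pverts G. N \<le> depth v \<longrightarrow> norm (vdiff g v) < e)"
proof -
  have "eventually P (inf (filtercomap depth at_top) (principal (pverts G))) \<longleftrightarrow>
      (\<exists>N. \<forall>v \<in> pverts G. N \<le> depth v \<longrightarrow> P v)" for P
    by (auto simp: eventually_inf_principal eventually_filtercomap_at_top_linorder)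
  then show ?thesis
    by (simp add: little_lipschitz_def tendsto_iff)
qed

lemma vdiff_add: "vdiff (\<lambda>v. g v + h v) = (\<lambda>v. vdiff g v + vdiff h v)"
  by (auto simp: vdiff_def)

lemma vdiff_scale: "vdiff (\<lambda>v. c * g v) = (\<lambda>v. c * vdiff g v)"
  by (auto simp: vdiff_def right_diff_distrib)

lemma little_lipschitz_add:
  "\<lbrakk>g \<in> little_lipschitz; h \<in> little_lipschitz\<rbrakk> \<Longrightarrow> (\<lambda>v. g v + h v) \<in> little_lipschitz"
  by (auto simp: little_lipschitz_def vertex_funs_def vdiff_add intro: tendsto_add_zero)

lemma little_lipschitz_scale:
  "g \<in> little_lipschitz \<Longrightarrow> (\<lambda>v. c * g v) \<in> little_lipschitz"
  by (auto simp: little_lipschitz_def vertex_funs_def vdiff_scale intro: tendsto_mult_right_zero)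

text \<open>
  The derivative is small off a set of vertices of bounded depth, and that set is finite. Without
  this the supremum in \<open>lipschitz_norm\<close> would be an unspecified real number.
\<close>

lemma bdd_above_vdiff:
  assumes "locally_finite" "g \<in> little_lipschitz"
  shows "bdd_above ((\<lambda>v. norm (vdiff g v)) ` pverts G)"
proof -
  obtain N where N: "\<And>v. \<lbrakk>v \<in> pverts G; N \<le> depth v\<rbrakk> \<Longrightarrow> norm (vdiff g v) < 1"
    using assms(2) zero_less_one unfolding little_lipschitz_iff by blast
  let ?V = "{v \<in> pverts G. depth v < N}"
  have "(\<lambda>v. norm (vdiff g v)) ` pverts G \<subseteq> (\<lambda>v. norm (vdiff g v)) ` ?V \<union> {..1}"
    using N by (force simp: not_less)
  moreover have "bdd_above ((\<lambda>v. norm (vdiff g v)) ` ?V \<union> {..1})"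
    using finite_depth_less[OF assms(1)] by (simp add: bdd_above_finite)
  ultimately show ?thesis
    by (rule bdd_above_mono[rotated])
qed

lemma norm_vdiff_le:
  assumes "locally_finite" "g \<in> little_lipschitz" "v \<in> pverts G"
  shows "norm (vdiff g v) \<le> lipschitz_norm g"
  unfolding lipschitz_norm_def by (intro cSUP_upper bdd_above_vdiff assms)

lemma lipschitz_norm_nonneg:
  assumes "locally_finite" "g \<in> little_lipschitz"
  shows "0 \<le> lipschitz_norm g"
  using norm_vdiff_le[OF assms root_in_verts] norm_ge_zero order_trans by blast

text \<open>
  At a child \<open>v\<close> of the root this reads \<open>g root = vdiff g root\<close>: the convention for the
  derivative at the root amounts to extending \<open>g\<close> by zero beyond the root, and \<open>S\<close> shifts
  this extension.
\<close>

lemma vdiff_forward_shift: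
  assumes "v \<in> pverts G"
  shows "vdiff (forward_shift g) v = (if v = root then 0 else vdiff g (par v))"
  using assms par_in_verts[of v] by (auto simp: vdiff_def forward_shift_def)

lemma forward_shift_little_lipschitz:
  assumes "g \<in> little_lipschitz"
  shows "forward_shift g \<in> little_lipschitz"
  unfolding little_lipschitz_iff
proof (intro conjI allI impI)
  show "forward_shift g \<in> vertex_funs"
    by (simp add: vertex_funs_def forward_shift_def)
  fix e :: real
  assume "e > 0"
  then obtain N where N: "\<And>v. \<lbrakk>v \<in> pverts G; N \<le> depth v\<rbrakk> \<Longrightarrow> norm (vdiff g v) < e"
    using assms unfolding little_lipschitz_iff by blast
  have "norm (vdiff (forward_shift g) v) < e" if "v \<in> pverts G" "Suc N \<le> depth v" for v
    using that N[of "par v"] \<open>e > 0\<close>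
    by (auto simp: vdiff_forward_shift par_in_verts depth_par)
  then show "\<exists>N. \<forall>v \<in> pverts G. N \<le> depth v \<longrightarrow> norm (vdiff (forward_shift g) v) < e"
    by blast
qed

lemma lipschitz_norm_forward_shift_le:
  assumes "locally_finite" "g \<in> little_lipschitz"
  shows "lipschitz_norm (forward_shift g) \<le> lipschitz_norm g"
  unfolding lipschitz_norm_def[of "forward_shift g"]
proof (rule cSUP_least)
  show "norm (vdiff (forward_shift g) v) \<le> lipschitz_norm g" if "v \<in> pverts G" for v
    using that norm_vdiff_le[OF assms] lipschitz_norm_nonneg[OF assms]
    by (simp add: vdiff_forward_shift par_in_verts)
qed (use root_in_verts in auto)

lemma bounded_operator_forward_shift:
  assumes "locally_finite"
  shows "bounded_operator forward_shift"
  unfolding bounded_operator_def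
proof (intro conjI ballI allI)
  show "\<exists>K. \<forall>g \<in> little_lipschitz. lipschitz_norm (forward_shift g) \<le> K * lipschitz_norm g"
    using lipschitz_norm_forward_shift_le[OF assms] by (intro exI[of _ 1]) simp
qed (auto simp: forward_shift_def forward_shift_little_lipschitz)

section \<open>The functionals on the little Lipschitz space given by summable functions\<close>

lemma
  assumes "locally_finite" "f \<in> L1" "g \<in> little_lipschitz"
  shows pairing_abs_summable: "(\<lambda>v. norm (f v * vdiff g v)) summable_on pverts G"
    and norm_pairing_le:
      "norm (\<Sum>\<^sub>\<infinity>v \<in> pverts G. f v * vdiff g v)
         \<le> (\<Sum>\<^sub>\<infinity>v \<in> pverts G. norm (f v)) * lipschitz_norm g"
proof -
  have f: "(\<lambda>v. norm (f v)) summable_on pverts G"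
    using assms(2) by (simp add: L1_def)
  have le: "norm (f v * vdiff g v) \<le> norm (f v) * lipschitz_norm g" if "v \<in> pverts G" for v
    unfolding norm_mult by (intro mult_left_mono norm_vdiff_le that assms norm_ge_zero)
  have s: "(\<lambda>v. norm (f v) * lipschitz_norm g) summable_on pverts G"
    by (rule summable_on_cmult_left) (rule f)
  show abs: "(\<lambda>v. norm (f v * vdiff g v)) summable_on pverts G"
    by (rule Infinite_Sum.abs_summable_on_comparison_test'[OF s le])
  have "norm (\<Sum>\<^sub>\<infinity>v \<in> pverts G. f v * vdiff g v)
      \<le> (\<Sum>\<^sub>\<infinity>v \<in> pverts G. norm (f v * vdiff g v))"
    by (rule norm_infsum_bound) (rule abs)
  also have "\<dots> \<le> (\<Sum>\<^sub>\<infinity>v \<in> pverts G. norm (f v) * lipschitz_norm g)"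
    by (rule infsum_mono[OF abs s le])
  also have "\<dots> = (\<Sum>\<^sub>\<infinity>v \<in> pverts G. norm (f v)) * lipschitz_norm g"
    by (rule infsum_cmult_left) (use f in simp)
  finally show "norm (\<Sum>\<^sub>\<infinity>v \<in> pverts G. f v * vdiff g v)
      \<le> (\<Sum>\<^sub>\<infinity>v \<in> pverts G. norm (f v)) * lipschitz_norm g" .
qed

lemma \<Phi>_in_dual:
  assumes "locally_finite" "f \<in> L1"
  shows "\<Phi> f \<in> dual"
proof -
  note s = abs_summable_summable[OF pairing_abs_summable[OF assms]]
  have "\<Phi> f (\<lambda>v. g v + h v) = \<Phi> f g + \<Phi> f h"
    if "g \<in> little_lipschitz" "h \<in> little_lipschitz" for g h
    using that infsum_add[OF s[OF that(1)] s[OF that(2)]]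
    by (simp add: \<Phi>_def little_lipschitz_add vdiff_add distrib_left)
  moreover have "\<Phi> f (\<lambda>v. c * g v) = c * \<Phi> f g" if "g \<in> little_lipschitz" for c g
    using that infsum_cmult_right[OF s[OF that], of c]
    by (simp add: \<Phi>_def little_lipschitz_scale vdiff_scale mult.left_commute)
  moreover have "\<forall>g \<in> little_lipschitz.
      norm (\<Phi> f g) \<le> (\<Sum>\<^sub>\<infinity>v \<in> pverts G. norm (f v)) * lipschitz_norm g"
    using norm_pairing_le[OF assms] by (simp add: \<Phi>_def)
  moreover have "\<Phi> f \<in> extensional little_lipschitz"
    by (simp add: \<Phi>_def)
  ultimately show ?thesis
    unfolding dual_def by blast
qed

text \<open>The discrete antiderivative: its increment along the arc into \<open>v\<close> is \<open>h v\<close>.\<close>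

definition path_sum :: "('a \<Rightarrow> complex) \<Rightarrow> 'a \<Rightarrow> complex" where
  "path_sum h v =
     (if v \<in> pverts G then h root + (\<Sum>e \<leftarrow> root_path v. h (snd e)) else 0)"

lemma vdiff_path_sum:
  assumes "v \<in> pverts G"
  shows "vdiff (path_sum h) v = h v"
  using assms par_in_verts[of v] root_in_verts root_path_par[of v]
  by (auto simp: vdiff_def path_sum_def)

text \<open>
  Evaluation at a vertex \<open>u\<close> is pairing with the function whose derivative is the point mass at
  \<open>u\<close>, namely the indicator function of the subtree of descendants of \<open>u\<close>.
\<close>

lemma \<Phi>_evaluation:
  assumes "u \<in> pverts G"
  shows "\<exists>g \<in> little_lipschitz. \<forall>f. \<Phi> f g = f u"
proof
  let ?g = "path_sum (\<lambda>v. if v = u then 1 else 0)"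
  have "norm (vdiff ?g v) < e" if "v \<in> pverts G" "Suc (depth u) \<le> depth v" "e > 0" for v e
    using that by (auto simp: vdiff_path_sum)
  then show g: "?g \<in> little_lipschitz"
    unfolding little_lipschitz_iff by (auto simp: vertex_funs_def path_sum_def)
  have "(\<Sum>\<^sub>\<infinity>v \<in> pverts G. f v * vdiff ?g v) = (\<Sum>\<^sub>\<infinity>v \<in> {u}. f v)" for f
    by (rule infsum_cong_neutral) (use assms in \<open>auto simp: vdiff_path_sum\<close>)
  then show "\<forall>f. \<Phi> f ?g = f u"
    using g by (simp add: \<Phi>_def)
qed

lemma inj_on_\<Phi>: "inj_on \<Phi> L1"
proof (rule inj_onI)
  fix f h
  assume "f \<in> L1" "h \<in> L1" and eq: "\<Phi> f = \<Phi> h"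
  then have "f v = h v" if "v \<notin> pverts G" for v
    using that by (simp add: L1_def vertex_funs_def)
  moreover have "f v = h v" if "v \<in> pverts G" for v
    using \<Phi>_evaluation[OF that] eq by metis
  ultimately show "f = h"
    by blast
qed

section \<open>Summation over children\<close>

text \<open>The sets \<open>Chi v\<close> are the fibres of \<open>par\<close>, so they partition its domain.\<close>

lemma bij_betw_Sigma_Chi: "bij_betw snd (Sigma (pverts G) Chi) (pverts G - {root})"
  by (rule bij_betw_byWitness[where f' = "\<lambda>w. (par w, w)"])
    (auto simp: Chi_def par_in_verts)

text \<open>
  Grouping the terms by parent. Absolute summability passes to the family over \<open>Sigma\<close>, where
  an iterated sum equals the sum over pairs; the inner sums are finite by local finiteness.
\<close>

lemma
  fixes F :: "'a \<Rightarrow> complex"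
  assumes "locally_finite" "(\<lambda>v. norm (F v)) summable_on pverts G"
  shows sum_Chi_abs_summable: "(\<lambda>v. norm (\<Sum>w \<in> Chi v. F w)) summable_on pverts G"
    and infsum_sum_Chi:
      "(\<Sum>\<^sub>\<infinity>v \<in> pverts G. \<Sum>w \<in> Chi v. F w) = (\<Sum>\<^sub>\<infinity>w \<in> pverts G - {root}. F w)"
proof -
  have "(\<lambda>v. norm (F v)) summable_on (pverts G - {root})"
    using assms(2) by (rule summable_on_subset_banach) blast
  then have abs: "(\<lambda>x. norm (F (snd x))) summable_on Sigma (pverts G) Chi"
    using summable_on_reindex_bij_betw[OF bij_betw_Sigma_Chi, of "\<lambda>w. norm (F w)"] by simp
  have "(\<lambda>v. \<Sum>\<^sub>\<infinity>w \<in> Chi v. norm (F (snd (v, w)))) summable_on pverts G"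
    by (rule summable_on_Sigma_banach) (use abs in \<open>simp add: case_prod_unfold\<close>)
  then have "(\<lambda>v. \<Sum>w \<in> Chi v. norm (F w)) summable_on pverts G"
    by (simp add: finite_Chi[OF assms(1)])
  then show "(\<lambda>v. norm (\<Sum>w \<in> Chi v. F w)) summable_on pverts G"
    by (rule Infinite_Sum.abs_summable_on_comparison_test') (rule norm_sum)
  show "(\<Sum>\<^sub>\<infinity>v \<in> pverts G. \<Sum>w \<in> Chi v. F w) = (\<Sum>\<^sub>\<infinity>w \<in> pverts G - {root}. F w)"
    using infsum_Sigma_banach[OF abs_summable_summable[OF abs]]
      infsum_reindex_bij_betw[OF bij_betw_Sigma_Chi, of F]
    by (simp add: finite_Chi[OF assms(1)])
qed

lemma backward_shift_L1:
  assumes "locally_finite" "f \<in> L1"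
  shows "backward_shift f \<in> L1"
proof -
  have "(\<lambda>v. norm (backward_shift f v)) summable_on pverts G"
    using sum_Chi_abs_summable[OF assms(1), of f] assms(2)
    by (simp add: L1_def backward_shift_def)
  then show ?thesis
    by (simp add: L1_def vertex_funs_def backward_shift_def Chi_outside_verts)
qed

lemma adjoint_forward_shift:
  assumes "locally_finite" "f \<in> L1"
  shows "adjoint forward_shift (\<Phi> f) = \<Phi> (backward_shift f)"
proof
  fix g
  show "adjoint forward_shift (\<Phi> f) g = \<Phi> (backward_shift f) g"
  proof (cases "g \<in> little_lipschitz")
    case True
    let ?F = "\<lambda>w. f w * vdiff (forward_shift g) w"
    note Sg = forward_shift_little_lipschitz[OF True]
    have "\<Phi> f (forward_shift g) = (\<Sum>\<^sub>\<infinity>w \<in> pverts G. ?F w)"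
      by (simp add: \<Phi>_def Sg)
    also have "\<dots> = (\<Sum>\<^sub>\<infinity>w \<in> pverts G - {root}. ?F w)"
      by (rule infsum_cong_neutral) (auto simp: vdiff_forward_shift root_in_verts)
    also have "\<dots> = (\<Sum>\<^sub>\<infinity>v \<in> pverts G. \<Sum>w \<in> Chi v. ?F w)"
      by (rule infsum_sum_Chi[symmetric])
        (intro assms(1) pairing_abs_summable assms Sg)+
    also have "\<dots> = (\<Sum>\<^sub>\<infinity>v \<in> pverts G. backward_shift f v * vdiff g v)"
      by (rule infsum_cong)
        (auto simp: backward_shift_def sum_distrib_right Chi_def vdiff_forward_shift intro!: sum.cong)
    also have "\<dots> = \<Phi> (backward_shift f) g"
      by (simp add: \<Phi>_def True)
    finally show ?thesis
      by (simp add: adjoint_def True)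
  qed (simp add: adjoint_def \<Phi>_def)
qed

lemma L1_adjoint_forward_shift:
  assumes "locally_finite" "f \<in> L1"
  shows "L1_adjoint forward_shift f = backward_shift f"
  unfolding L1_adjoint_def adjoint_forward_shift[OF assms]
  by (rule the_inv_into_f_f[OF inj_on_\<Phi> backward_shift_L1[OF assms]])

end

theorem proposition3p7:
  fixes G :: "'a pair_pre_digraph" and root :: 'a
  assumes "rooted_tree G root"
    and "countable (pverts G)" and "infinite (pverts G)"
    and "rooted_tree.locally_finite G"
  shows "rooted_tree.bounded_operator G root (rooted_tree.forward_shift G root)
    \<and> (\<forall>f \<in> rooted_tree.L1 G.
         rooted_tree.\<Phi> G root f \<in> rooted_tree.dual G root
         \<and> rooted_tree.backward_shift G root f \<in> rooted_tree.L1 G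
         \<and> rooted_tree.adjoint G root (rooted_tree.forward_shift G root) (rooted_tree.\<Phi> G root f)
             = rooted_tree.\<Phi> G root (rooted_tree.backward_shift G root f)
         \<and> rooted_tree.L1_adjoint G root (rooted_tree.forward_shift G root) f
             = rooted_tree.backward_shift G root f)"
proof -
  interpret rooted_tree G root
    by fact
  show ?thesis
    using assms(4) bounded_operator_forward_shift \<Phi>_in_dual backward_shift_L1
      adjoint_forward_shift L1_adjoint_forward_shift
    by blast
qed

end
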